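(* Let $X$, $(\Omega,\mathbb{R})$, $\Pi_t$ and $G$ be as in the context. Assume: $\Omega$ is minimal; $G$ is connected and its action on $X$ is order-preserving; $\Pi_t$ is monotone and the action of $G$ commutes with $\Pi_t$; and assume that $G$ is locally compact. Let $K=\{(\bar u_\omega,\omega):\omega\in\Omega\}\subset X\times\Omega$ be a minimal set of $\Pi_t$ which is a uniformly stable $1$-cover of $\Omega$, and assume that there exists $\delta>0$ such that (i) the forward orbit $O^+(x_0,\omega_0)$ is relatively compact for every $(x_0,\omega_0)\in B_\delta(K)$; and (ii) whenever (for such a point) the omega-limit set satisfies $\mathcal{O}(x_0,\omega_0)\subset B_\delta(K)$ and $\mathcal{O}(x_0,\omega_0)\prec hK$ (resp. $\mathcal{O}(x_0,\omega_0)\succ hK$) for some $h\in G$, there is a neighborhood $B(e)\subset G$ of the unit $e$ such that $\mathcal{O}(x_0,\omega_0)\prec ghK$ (resp. $\mathcal{O}(x_0,\omega_0)\succ ghK$) for all $g\in B(e)$. If $G$ is a compact group, then $K$ is $G$-symmetric, i.e. $GK=K$.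
   Context: Ordered space: $(V,\|\cdot\|)$ is a Banach space ordered by a closed convex cone $V_+$ with $V_+\cap(-V_+)=\{0\}$; $x_1\le x_2$ iff $x_2-x_1\in V_+$, and $x_1<x_2$ iff $x_1\le x_2$ and $x_1\ne x_2$. $X\subset V$ is a closed order convex subset (order convex: for $a<b$ in $X$ the segment $\{a+s(b-a):s\in[0,1]\}$ lies in $X$). Standing assumption: for all $u,v\in X$ the greatest lower bound $u\wedge v$ exists, and $(u,v)\mapsto u\wedge v$ is continuous $X\times X\to X$. Base flow: $\Omega$ is a compact metric space with a continuous flow $(\omega,t)\mapsto\omega\cdot t$, $t\in\mathbb{R}$; it is minimal if it has no nonempty proper compact invariant subset. Skew-product semiflow: $\Pi_t(x,\omega)=(u(t,x,\omega),\omega\cdot t)$, $t\ge0$, is a continuous map $\mathbb{R}^+\times X\times\Omega\to X\times\Omega$ with $\Pi_0=\mathrm{Id}$ and $u(t+s,x,\omega)=u(s,u(t,x,\omega),\omega\cdot t)$. It is monotone if $x_1\le x_2$ implies $u(t,x_1,\omega)\le u(t,x_2,\omega)$ for all $\omega\in\Omega$, $t\ge0$. Forward orbit: $O^+(x,\omega)=\{\Pi_t(x,\omega):t\ge0\}$. Omega-limit set: $\mathcal{O}(x,\omega)$ is the set of limits of $\Pi_{t_n}(x,\omega)$ over sequences $t_n\to\infty$. 1-cover: a compact positively invariant $K\subset X\times\Omega$ such that over every $\omega\in\Omega$ there is exactly one point $(\bar u_\omega,\omega)$ of $K$; then $\omega\mapsto\bar u_\omega$ is continuous and $u(t,\bar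 u_\omega,\omega)=\bar u_{\omega\cdot t}$ for $t\ge0$. $K$ is uniformly stable if for every $\varepsilon>0$ there is $\delta(\varepsilon)>0$ such that for $(x,\omega)\in K$, $(y,\omega)\in X\times\Omega$ with $\|x-y\|\le\delta(\varepsilon)$ one has $\|u(t,x,\omega)-u(t,y,\omega)\|<\varepsilon$ for all $t\ge0$. $B_\delta(K)=\{(x,\omega)\in X\times\Omega:\|x-\bar u_\omega\|<\delta\}$. Order of sets: for compact positively invariant $K_1,K_2\subset X\times\Omega$, $K_1\preceq K_2$ (resp. $K_1\prec K_2$) means: for every $(x,\omega)\in K_1$ there is $(y,\omega)\in K_2$ with $x\le y$ (resp. $x<y$), and for every $(y,\omega)\in K_2$ there is $(x,\omega)\in K_1$ with $x\le y$ (resp. $x<y$). $K_1\succeq K_2$, $K_1\succ K_2$ are defined analogously. Group action: $G$ is a metrizable topological group with unit $e$, acting continuously on $X$ ($G\times X\to X$, $(a,x)\mapsto ax$, by homeomorphisms, with $a\mapsto(x\mapsto ax)$ a group homomorphism). The action is order-preserving if $x_1\le x_2$ implies $ax_1\le ax_2$; it commutes with $\Pi_t$ if $a\,u(t,x,\omega)=u(t,ax,\omega)$ for all $a\in G$, $(x,\omega)\in X\times\Omega$, $t\ge0$. $gK=\{(g\bar u_\omega,\omega):\omega\in\Omega\}$, $GK=\{(g\bar u_\omega,\omega):g\in G,\ \omega\in\Omega\}$. *)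

theory Defs
  imports "HOL-Analysis.Analysis"
begin

text \<open>
  Conventions used throughout.

  The ordered Banach space has a type of sort \<open>{banach, ordered_real_vector}\<close>; its
  cone is \<open>{v. 0 \<le> v}\<close>. The class axioms make this set a convex cone that meets its
  negative only in \<open>0\<close>, and conversely every such cone gives an instance. Closedness of
  the cone is not part of the class and is required separately.

  The group is a type of sort \<open>topological_group_add\<close>. That class is not commutative;
  it merely writes the group additively, so \<open>0\<close> is the unit \<open>e\<close> and \<open>g + h\<close> is the
  product \<open>gh\<close>.
\<close>

definition order_convex :: "'v::ordered_real_vector set \<Rightarrow> bool" where
  "order_convex X \<longleftrightarrow> (\<forall>a\<in>X. \<forall>b\<in>X. a < b \<longrightarrow> (\<forall>s\<in>{0..1}. a + s *\<^sub>R (b - a) \<in> X))"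

text \<open>Greatest lower bounds are taken in the ordered set \<open>X\<close>.\<close>

definition is_glb_in :: "'v::order set \<Rightarrow> 'v \<Rightarrow> 'v \<Rightarrow> 'v \<Rightarrow> bool" where
  "is_glb_in X u v m \<longleftrightarrow> m \<in> X \<and> m \<le> u \<and> m \<le> v \<and> (\<forall>z\<in>X. z \<le> u \<and> z \<le> v \<longrightarrow> z \<le> m)"

definition has_continuous_meet :: "'v::{topological_space, order} set \<Rightarrow> bool" where
  "has_continuous_meet X \<longleftrightarrow>
     (\<exists>meet. (\<forall>u\<in>X. \<forall>v\<in>X. is_glb_in X u v (meet u v)) \<and>
             continuous_on (X \<times> X) (\<lambda>(u, v). meet u v))"

definition continuous_flow :: "('w::topological_space \<Rightarrow> real \<Rightarrow> 'w) \<Rightarrow> bool" where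
  "continuous_flow \<phi> \<longleftrightarrow>
     continuous_on UNIV (\<lambda>(w, t). \<phi> w t) \<and>
     (\<forall>w. \<phi> w 0 = w) \<and>
     (\<forall>w s t. \<phi> w (s + t) = \<phi> (\<phi> w s) t)"

definition minimal_flow :: "('w::topological_space \<Rightarrow> real \<Rightarrow> 'w) \<Rightarrow> bool" where
  "minimal_flow \<phi> \<longleftrightarrow>
     \<not> (\<exists>S. S \<noteq> {} \<and> S \<noteq> UNIV \<and> compact S \<and> (\<forall>t. (\<lambda>w. \<phi> w t) ` S = S))"

definition skew_product ::
    "(real \<Rightarrow> 'v \<Rightarrow> 'w \<Rightarrow> 'v) \<Rightarrow> ('w \<Rightarrow> real \<Rightarrow> 'w) \<Rightarrow> real \<Rightarrow> 'v \<times> 'w \<Rightarrow> 'v \<times> 'w" where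
  "skew_product u \<phi> t = (\<lambda>(x, w). (u t x w, \<phi> w t))"

text \<open>The values of \<open>u\<close> at negative times or outside \<open>X\<close> are irrelevant.\<close>

definition skew_product_semiflow ::
    "'v::topological_space set \<Rightarrow> ('w::topological_space \<Rightarrow> real \<Rightarrow> 'w) \<Rightarrow>
     (real \<Rightarrow> 'v \<Rightarrow> 'w \<Rightarrow> 'v) \<Rightarrow> bool" where
  "skew_product_semiflow X \<phi> u \<longleftrightarrow>
     (\<forall>t\<ge>0. skew_product u \<phi> t ` (X \<times> UNIV) \<subseteq> X \<times> UNIV) \<and>
     continuous_on ({0..} \<times> (X \<times> UNIV)) (\<lambda>(t, z). skew_product u \<phi> t z) \<and>
     (\<forall>z\<in>X \<times> UNIV. skew_product u \<phi> 0 z = z) \<and>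
     (\<forall>t\<ge>0. \<forall>s\<ge>0. \<forall>x\<in>X. \<forall>w. u (t + s) x w = u s (u t x w) (\<phi> w t))"

definition monotone_semiflow :: "'v::order set \<Rightarrow> (real \<Rightarrow> 'v \<Rightarrow> 'w \<Rightarrow> 'v) \<Rightarrow> bool" where
  "monotone_semiflow X u \<longleftrightarrow>
     (\<forall>x1\<in>X. \<forall>x2\<in>X. x1 \<le> x2 \<longrightarrow> (\<forall>w. \<forall>t\<ge>0. u t x1 w \<le> u t x2 w))"

definition forward_orbit :: "(real \<Rightarrow> 'z \<Rightarrow> 'z) \<Rightarrow> 'z \<Rightarrow> 'z set" where
  "forward_orbit P z = {P t z |t. 0 \<le> t}"

definition omega_limit :: "(real \<Rightarrow> 'z \<Rightarrow> 'z::topological_space) \<Rightarrow> 'z \<Rightarrow> 'z set" where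
  "omega_limit P z =
     {y. \<exists>t::nat \<Rightarrow> real. (\<forall>n. 0 \<le> t n) \<and> filterlim t at_top sequentially \<and>
           (\<lambda>n. P (t n) z) \<longlonglongrightarrow> y}"

definition positively_invariant :: "(real \<Rightarrow> 'z \<Rightarrow> 'z) \<Rightarrow> 'z set \<Rightarrow> bool" where
  "positively_invariant P S \<longleftrightarrow> (\<forall>t\<ge>0. P t ` S \<subseteq> S)"

definition minimal_set :: "(real \<Rightarrow> 'z \<Rightarrow> 'z::topological_space) \<Rightarrow> 'z set \<Rightarrow> bool" where
  "minimal_set P M \<longleftrightarrow>
     M \<noteq> {} \<and> compact M \<and> positively_invariant P M \<and>
     (\<forall>S. S \<noteq> {} \<and> S \<subseteq> M \<and> compact S \<and> positively_invariant P S \<longrightarrow> S = M)"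

definition one_cover ::
    "'v::topological_space set \<Rightarrow> (real \<Rightarrow> 'v \<times> 'w::topological_space \<Rightarrow> 'v \<times> 'w) \<Rightarrow>
     ('v \<times> 'w) set \<Rightarrow> bool" where
  "one_cover X P K \<longleftrightarrow>
     K \<subseteq> X \<times> UNIV \<and> compact K \<and> positively_invariant P K \<and> (\<forall>w. \<exists>!x. (x, w) \<in> K)"

definition uniformly_stable ::
    "'v::real_normed_vector set \<Rightarrow> (real \<Rightarrow> 'v \<Rightarrow> 'w \<Rightarrow> 'v) \<Rightarrow> ('v \<times> 'w) set \<Rightarrow> bool" where
  "uniformly_stable X u K \<longleftrightarrow>
     (\<forall>\<epsilon>>0. \<exists>\<delta>>0. \<forall>x y w. (x, w) \<in> K \<and> y \<in> X \<and> norm (x - y) \<le> \<delta> \<longrightarrow>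
        (\<forall>t\<ge>0. norm (u t x w - u t y w) < \<epsilon>))"

text \<open>The set \<open>B\<^sub>\<delta>(K)\<close> for the 1-cover \<open>K = {(ubar w, w) | w}\<close>.\<close>

definition tube :: "'v::real_normed_vector set \<Rightarrow> ('w \<Rightarrow> 'v) \<Rightarrow> real \<Rightarrow> ('v \<times> 'w) set" where
  "tube X ubar \<delta> = {(x, w). x \<in> X \<and> norm (x - ubar w) < \<delta>}"

definition set_less :: "('v::order \<times> 'w) set \<Rightarrow> ('v \<times> 'w) set \<Rightarrow> bool" where
  "set_less K1 K2 \<longleftrightarrow>
     (\<forall>(x, w)\<in>K1. \<exists>y. (y, w) \<in> K2 \<and> x < y) \<and>
     (\<forall>(y, w)\<in>K2. \<exists>x. (x, w) \<in> K1 \<and> x < y)"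

definition set_greater :: "('v::order \<times> 'w) set \<Rightarrow> ('v \<times> 'w) set \<Rightarrow> bool" where
  "set_greater K1 K2 \<longleftrightarrow>
     (\<forall>(x, w)\<in>K1. \<exists>y. (y, w) \<in> K2 \<and> x > y) \<and>
     (\<forall>(y, w)\<in>K2. \<exists>x. (x, w) \<in> K1 \<and> x > y)"

definition continuous_action ::
    "'v::topological_space set \<Rightarrow> ('g::topological_group_add \<Rightarrow> 'v \<Rightarrow> 'v) \<Rightarrow> bool" where
  "continuous_action X act \<longleftrightarrow>
     continuous_on (UNIV \<times> X) (\<lambda>(a, x). act a x) \<and>
     (\<forall>a. \<exists>b. homeomorphism X X (act a) b) \<and>
     (\<forall>x\<in>X. act 0 x = x) \<and>
     (\<forall>a b. \<forall>x\<in>X. act (a + b) x = act a (act b x))"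

definition order_preserving_action :: "'v::order set \<Rightarrow> ('g \<Rightarrow> 'v \<Rightarrow> 'v) \<Rightarrow> bool" where
  "order_preserving_action X act \<longleftrightarrow>
     (\<forall>a. \<forall>x1\<in>X. \<forall>x2\<in>X. x1 \<le> x2 \<longrightarrow> act a x1 \<le> act a x2)"

definition action_commutes ::
    "'v set \<Rightarrow> ('g \<Rightarrow> 'v \<Rightarrow> 'v) \<Rightarrow> (real \<Rightarrow> 'v \<Rightarrow> 'w \<Rightarrow> 'v) \<Rightarrow> bool" where
  "action_commutes X act u \<longleftrightarrow>
     (\<forall>a. \<forall>x\<in>X. \<forall>w. \<forall>t\<ge>0. act a (u t x w) = u t (act a x) w)"

definition translate :: "('g \<Rightarrow> 'v \<Rightarrow> 'v) \<Rightarrow> 'g \<Rightarrow> ('v \<times> 'w) set \<Rightarrow> ('v \<times> 'w) set" where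
  "translate act g K = {(act g x, w) |x w. (x, w) \<in> K}"

definition group_orbit :: "('g \<Rightarrow> 'v \<Rightarrow> 'v) \<Rightarrow> ('v \<times> 'w) set \<Rightarrow> ('v \<times> 'w) set" where
  "group_orbit act K = {(act g x, w) |g x w. (x, w) \<in> K}"

end

theory Submission
  imports Defs
begin

text \<open>
  In a compact group a closed subsemigroup is a group, so \<open>gK \<preceq> K\<close> already forces \<open>gK = K\<close>.
  Let \<open>x \<le> ubar w0\<close> be close to \<open>K\<close>. The set of \<open>g\<close> for which \<open>gK\<close> lies above the omega-limit
  set of \<open>(x, w0)\<close> is closed and contains the unit. If the omega-limit set touches some such
  \<open>gK\<close>, stability makes it equal to \<open>gK\<close>, whence \<open>gK \<preceq> K\<close> and it equals \<open>K\<close>. Otherwise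
  the push condition makes the set of such \<open>g\<close> open, hence all of \<open>G\<close>. So the omega-limit set
  either is \<open>K\<close> or lies strictly below every \<open>gK\<close>.

  If the second case occurs for \<open>x\<close> arbitrarily close to \<open>ubar w0\<close>, stability gives \<open>K \<preceq> gK\<close> in
  the limit, for all \<open>g\<close>. If not, then for \<open>g\<close> near the unit the orbit starting from the meet of
  \<open>ubar w0\<close> and its \<open>g\<close>-translate converges to \<open>K\<close> while staying below \<open>gK\<close>, so
  \<open>K \<preceq> gK\<close>; the stabilizer of \<open>K\<close> is then open and closed.
\<close>

section \<open>Topological groups: connectedness and closed subsemigroups\<close>

lemma connected_clopen_UNIV:
  fixes S :: "'a::topological_space set"
  assumes "connected (UNIV :: 'a set)" "open S" "closed S" "a \<in> S"
  shows "S = UNIV"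
proof -
  have "openin (top_of_set UNIV) S" "closedin (top_of_set UNIV) S"
    using assms(2,3) open_subset closed_subset subset_UNIV by metis+
  then show ?thesis
    using assms(1,4) unfolding connected_clopen by (metis empty_iff)
qed

text \<open>The push condition multiplies \<open>h\<close> on the left, so the neighborhoods of
  \<open>h\<close> that it provides are of the form \<open>Bh\<close>.\<close>

lemma open_right_translate:
  fixes B :: "'g::topological_group_add set"
  assumes "open B"
  shows "open {k. k - h \<in> B}"
proof -
  have "continuous_on UNIV (\<lambda>k::'g. k - h)"
    by (intro continuous_intros)
  then show ?thesis
    using assms by (simp add: continuous_on_open_vimage vimage_def)
qed

lemma closed_semigroup_uminus:
  fixes S :: "'g::topological_group_add set"
  assumes G: "compact (UNIV :: 'g set)" and S: "closed S" "0 \<in> S"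
    and add: "\<And>a b. a \<in> S \<Longrightarrow> b \<in> S \<Longrightarrow> a + b \<in> S" and h: "h \<in> S"
  shows "- h \<in> S"
proof (rule ccontr)
  assume "- h \<notin> S"
  \<comment> \<open>\<open>p n\<close> is the multiple \<open>n h\<close>. Its cluster point \<open>c\<close> yields \<open>n < m\<close> with \<open>(m - n) h\<close>
    near \<open>0\<close>, so \<open>(m - n - 1) h \<in> S\<close> is near \<open>- h\<close>.\<close>
  define p where "p n = ((\<lambda>x. h + x) ^^ n) 0" for n
  have p_Suc: "p (Suc n) = h + p n" for n
    by (simp add: p_def)
  have p_S: "p n \<in> S" for n
    by (induction n) (auto simp: p_Suc add h S p_def[of 0])
  have p_add: "p (n + m) = p n + p m" for n m
    by (induction n) (auto simp: p_Suc add.assoc p_def[of 0])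
  \<comment> \<open>A topological group need not be sequentially compact when it is compact, so a
    cluster point replaces a convergent subsequence.\<close>
  obtain c where c: "inf (nhds c) (filtermap p sequentially) \<noteq> bot"
    using G unfolding compact_filter
    by (metis (no_types, lifting) UNIV_I always_eventually filtermap_bot_iff sequentially_bot)
  have "((\<lambda>x. - h + (- fst x + snd x)) \<longlongrightarrow> - h + (- c + c)) (nhds c \<times>\<^sub>F nhds c)"
    by (intro tendsto_intros filterlim_fst filterlim_snd)
  \<comment> \<open>At \<open>(c, c)\<close> the map takes the value \<open>- h\<close>, which lies
    in the open set \<open>- S\<close>; a single predicate \<open>Q\<close> then serves both
    arguments.\<close>
  then have "\<forall>\<^sub>F x in nhds c \<times>\<^sub>F nhds c. - h + (- fst x + snd x) \<in> - S"
    using \<open>- h \<notin> S\<close> S by (intro topological_tendstoD) auto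
  then obtain Q where Q: "eventually Q (nhds c)"
    and QQ: "\<And>a b. Q a \<Longrightarrow> Q b \<Longrightarrow> - h + (- a + b) \<notin> S"
    unfolding eventually_prod_same by fastforce
  have hits: "\<exists>m\<ge>n. Q (p m)" for n
  proof (rule ccontr)
    assume "\<not> ?thesis"
    then have "eventually (\<lambda>x. \<not> Q x) (filtermap p sequentially)"
      by (auto simp: eventually_filtermap eventually_sequentially)
    with Q have "eventually (\<lambda>x. False) (inf (nhds c) (filtermap p sequentially))"
      unfolding eventually_inf by blast
    with c show False
      by (simp add: trivial_limit_def)
  qed
  obtain n where n: "Q (p n)"
    using hits by blast
  obtain m where m: "m \<ge> Suc n" "Q (p m)"
    using hits by blast
  define k where "k = m - Suc n"
  have "p m = p n + p (Suc k)"
    using m p_add[of n "Suc k"] by (simp add: k_def)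
  then have "- h + (- p n + p m) = p k"
    by (metis minus_add_cancel p_Suc)
  with QQ[OF n m(2)] p_S show False
    by metis
qed

section \<open>Recurrence in the minimal base flow\<close>

text \<open>The closures of the tails of the orbit intersect in the omega-limit set \<open>L\<close>
  of \<open>w0\<close>. It is nonempty by compactness, closed and invariant, so minimality makes it
  the whole space.\<close>

lemma minimal_flow_recurrent:
  fixes \<phi> :: "'w::metric_space \<Rightarrow> real \<Rightarrow> 'w"
  assumes cpt: "compact (UNIV :: 'w set)" and flow: "continuous_flow \<phi>"
    and minimal: "minimal_flow \<phi>"
  obtains t :: "nat \<Rightarrow> real" where "\<And>n. 0 \<le> t n" "filterlim t at_top sequentially"
    "(\<lambda>n. \<phi> w0 (t n)) \<longlonglongrightarrow> w"
proof -
  define L where "L = (\<Inter>n::nat. closure (\<phi> w0 ` {real n..}))"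
  have closed_L: "closed L"
    unfolding L_def by (intro closed_INT) auto
  have flow_add: "\<phi> w (s + t) = \<phi> (\<phi> w s) t" and flow_0: "\<phi> w 0 = w" for w s t
    using flow by (auto simp: continuous_flow_def)
  have cont: "continuous_on UNIV (\<lambda>w. \<phi> w s)" for s
    using continuous_on_compose2[of UNIV "\<lambda>(w, t). \<phi> w t" UNIV "\<lambda>w. (w, s)"] flow
    by (simp add: continuous_flow_def continuous_on_Pair)
  obtain l r where l: "strict_mono r" "((\<lambda>n. \<phi> w0 (real n)) \<circ> r) \<longlonglongrightarrow> l"
    using cpt[unfolded compact_eq_seq_compact_metric seq_compact_def] by (metis UNIV_I)
  have "l \<in> closure (\<phi> w0 ` {real n..})" for n
  proof (rule Lim_in_closed_set[OF closed_closure _ _ l(2)])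
    show "\<forall>\<^sub>F k in sequentially. ((\<lambda>n. \<phi> w0 (real n)) \<circ> r) k \<in> closure (\<phi> w0 ` {real n..})"
      unfolding eventually_sequentially o_def
      by (metis atLeast_iff closure_subset dual_order.trans imageI l(1) of_nat_le_iff
          seq_suble subsetD)
  qed simp
  then have "L \<noteq> {}"
    unfolding L_def by blast
  moreover have inv: "\<phi> w s \<in> L" if "w \<in> L" for w s
    unfolding L_def
  proof
    fix n :: nat
    \<comment> \<open>The time \<open>s\<close> may be negative, so the tail starts late enough for
      the shifted times to remain at least \<open>n\<close>.\<close>
    obtain m :: nat where m: "real m \<ge> real n - s"
      using real_arch_simple by blast
    have "(\<lambda>w. \<phi> w s) ` \<phi> w0 ` {real m..} \<subseteq> \<phi> w0 ` {real n..}"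
    proof clarify
      fix t assume "real m \<le> t"
      then have "t + s \<in> {real n..}"
        using m by simp
      then show "\<phi> (\<phi> w0 t) s \<in> \<phi> w0 ` {real n..}"
        by (metis flow_add imageI)
    qed
    then have "(\<lambda>w. \<phi> w s) ` closure (\<phi> w0 ` {real m..}) \<subseteq> closure (\<phi> w0 ` {real n..})"
      by (intro image_closure_subset continuous_on_subset[OF cont] closed_closure subset_UNIV
          subset_trans[OF _ closure_subset])
    then show "\<phi> w s \<in> closure (\<phi> w0 ` {real n..})"
      using that unfolding L_def by blast
  qed
  have "(\<lambda>w. \<phi> w t) ` L = L" for t
  proof
    show "L \<subseteq> (\<lambda>w. \<phi> w t) ` L"
    proof
      fix w assume "w \<in> L"
      \<comment> \<open>Invariance under the negative time \<open>- t\<close> supplies the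
        preimage.\<close>
      then have "\<phi> w (- t) \<in> L" "w = \<phi> (\<phi> w (- t)) t"
        using inv flow_add[of w "- t" t] flow_0 by auto
      then show "w \<in> (\<lambda>w. \<phi> w t) ` L"
        by blast
    qed
  qed (use inv in auto)
  moreover have "compact L"
    using cpt closed_L by (metis compact_Int_closed Int_UNIV_left)
  ultimately have "L = UNIV"
    using minimal unfolding minimal_flow_def by blast
  then have "w \<in> L"
    by simp
  then have "\<exists>t\<ge>real n. dist (\<phi> w0 t) w < inverse (real (Suc n))" for n
  proof -
    have "w \<in> closure (\<phi> w0 ` {real n..})"
      using \<open>w \<in> L\<close> unfolding L_def by blast
    then have "\<exists>v \<in> \<phi> w0 ` {real n..}. dist v w < inverse (real (Suc n))"
      unfolding closure_approachable by (simp del: of_nat_Suc)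
    then show ?thesis
      by auto
  qed
  then obtain t where t: "\<And>n. t n \<ge> real n"
    "\<And>n. dist (\<phi> w0 (t n)) w < inverse (real (Suc n))"
    by metis
  have "0 \<le> t n" for n
    using t(1)[of n] by linarith
  moreover have "filterlim t at_top sequentially"
    using t(1) by (intro filterlim_at_top_mono[OF filterlim_real_sequentially]) auto
  moreover have "(\<lambda>n. \<phi> w0 (t n)) \<longlonglongrightarrow> w"
  proof (rule metric_tendsto_imp_tendsto[OF LIMSEQ_inverse_real_of_nat])
    show "\<forall>\<^sub>F n in sequentially.
        dist (\<phi> w0 (t n)) w \<le> dist (inverse (real (Suc n))) 0"
      using less_imp_le[OF t(2)] by (intro always_eventually) (simp del: of_nat_Suc)
  qed
  ultimately show ?thesis
    using that by blast
qed

section \<open>Limits of inequalities, the setting and its basic rules\<close>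

lemma closed_cone_limit_le:
  fixes v w :: "nat \<Rightarrow> 'v::{real_normed_vector, ordered_ab_group_add}"
  assumes "closed {v::'v. 0 \<le> v}" "v \<longlonglongrightarrow> a" "w \<longlonglongrightarrow> b" "\<And>n. v n \<le> w n"
  shows "a \<le> b"
proof -
  have "b - a \<in> {v. 0 \<le> v}"
    by (rule Lim_in_closed_set[OF assms(1) _ _ tendsto_diff[OF assms(3,2)]]) (use assms(4) in auto)
  then show ?thesis
    by simp
qed

locale stable_cover =
  fixes X :: "'v::{banach, ordered_real_vector} set"
    and \<phi> :: "'w::metric_space \<Rightarrow> real \<Rightarrow> 'w"
    and u :: "real \<Rightarrow> 'v \<Rightarrow> 'w \<Rightarrow> 'v"
    and P :: "real \<Rightarrow> 'v \<times> 'w \<Rightarrow> 'v \<times> 'w"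
    and act :: "'g::topological_group_add \<Rightarrow> 'v \<Rightarrow> 'v"
    and ubar :: "'w \<Rightarrow> 'v"
    and K :: "('v \<times> 'w) set"
    and \<delta> :: real
  assumes closed_cone: "closed {v::'v. 0 \<le> v}"
    and X_closed: "closed X"
    and X_meet: "has_continuous_meet X"
    and Omega_compact: "compact (UNIV :: 'w set)"
    and flow: "continuous_flow \<phi>"
    and Omega_minimal: "minimal_flow \<phi>"
    and semiflow: "skew_product_semiflow X \<phi> u"
    and P_eq: "P = skew_product u \<phi>"
    and monotone: "monotone_semiflow X u"
    and G_connected: "connected (UNIV :: 'g set)"
    and action: "continuous_action X act"
    and action_order: "order_preserving_action X act"
    and action_commutes: "action_commutes X act u"
    and K_eq: "K = {(ubar w, w) |w. True}"
    and K_one_cover: "one_cover X P K"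
    and K_stable: "uniformly_stable X u K"
    and delta_pos: "\<delta> > 0"
    and relatively_compact:
      "\<And>z. z \<in> tube X ubar \<delta> \<Longrightarrow> compact (closure (forward_orbit P z))"
    and push_less:
      "\<And>z h. z \<in> tube X ubar \<delta> \<Longrightarrow> omega_limit P z \<subseteq> tube X ubar \<delta> \<Longrightarrow>
         set_less (omega_limit P z) (translate act h K) \<Longrightarrow>
         \<exists>B. open B \<and> 0 \<in> B \<and>
           (\<forall>g\<in>B. set_less (omega_limit P z) (translate act (g + h) K))"
    and G_compact: "compact (UNIV :: 'g set)"
begin

lemma P_pair: "P t (x, w) = (u t x w, \<phi> w t)"
  by (simp add: P_eq skew_product_def)

lemma ubar_X: "ubar w \<in> X"
  using K_one_cover by (auto simp: one_cover_def K_eq)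

lemma ubar_orbit: "0 \<le> t \<Longrightarrow> u t (ubar w) w = ubar (\<phi> w t)"
  using K_one_cover by (fastforce simp: one_cover_def positively_invariant_def K_eq P_pair)

text \<open>The projection of \<open>K\<close> to the base is a continuous bijection from a compact
  space to a Hausdorff space, so its inverse is continuous.\<close>

lemma continuous_ubar: "continuous_on UNIV ubar"
proof -
  have "snd ` K = UNIV"
    by (force simp: K_eq)
  moreover have "continuous_on (snd ` K) (\<lambda>w. (ubar w, w))"
    using K_one_cover
    by (intro continuous_on_inv continuous_intros) (auto simp: one_cover_def K_eq)
  ultimately have "continuous_on UNIV (\<lambda>w. (ubar w, w))"
    by simp
  from continuous_on_fst[OF this] show ?thesis
    by simp
qed

lemma tendsto_ubar: "w \<longlonglongrightarrow> w' \<Longrightarrow> (\<lambda>n::nat. ubar (w n)) \<longlonglongrightarrow> ubar w'"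
  using continuous_ubar by (simp add: continuous_on_tendsto_compose)

lemma u_X: "0 \<le> t \<Longrightarrow> x \<in> X \<Longrightarrow> u t x w \<in> X"
  using semiflow by (fastforce simp: skew_product_semiflow_def skew_product_def)

lemma u_add: "0 \<le> t \<Longrightarrow> 0 \<le> s \<Longrightarrow> x \<in> X \<Longrightarrow> u (t + s) x w = u s (u t x w) (\<phi> w t)"
  using semiflow by (simp add: skew_product_semiflow_def)

lemma flow_add: "\<phi> w (s + t) = \<phi> (\<phi> w s) t"
  using flow by (auto simp: continuous_flow_def)

lemma u_mono: "0 \<le> t \<Longrightarrow> x \<in> X \<Longrightarrow> y \<in> X \<Longrightarrow> x \<le> y \<Longrightarrow> u t x w \<le> u t y w"
  using monotone by (simp add: monotone_semiflow_def)

lemma act_X: "x \<in> X \<Longrightarrow> act g x \<in> X"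
  using action unfolding continuous_action_def homeomorphism_def by blast

lemma act_0: "x \<in> X \<Longrightarrow> act 0 x = x"
  and act_add: "x \<in> X \<Longrightarrow> act (a + b) x = act a (act b x)"
  using action by (auto simp: continuous_action_def)

lemma act_minus: "x \<in> X \<Longrightarrow> act (- a) (act a x) = x" "x \<in> X \<Longrightarrow> act a (act (- a) x) = x"
  by (simp_all flip: act_add add: act_0)

lemma act_mono: "x \<in> X \<Longrightarrow> y \<in> X \<Longrightarrow> x \<le> y \<Longrightarrow> act a x \<le> act a y"
  using action_order by (simp add: order_preserving_action_def)

lemma act_u: "0 \<le> t \<Longrightarrow> x \<in> X \<Longrightarrow> act a (u t x w) = u t (act a x) w"
  using action_commutes by (simp add: action_commutes_def)

lemma continuous_act_left: "x \<in> X \<Longrightarrow> continuous_on UNIV (\<lambda>g. act g x)"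
  using action continuous_on_compose2[of "UNIV \<times> X" "\<lambda>(a, x). act a x" UNIV "\<lambda>g. (g, x)"]
  by (auto simp: continuous_action_def continuous_on_Pair)

lemma continuous_act_right: "continuous_on X (act g)"
  using action continuous_on_compose2[of "UNIV \<times> X" "\<lambda>(a, x). act a x" X "\<lambda>x. (g, x)"]
  by (auto simp: continuous_action_def continuous_on_Pair)

lemma tendsto_act:
  "v \<longlonglongrightarrow> x \<Longrightarrow> (\<And>n. v n \<in> X) \<Longrightarrow> x \<in> X \<Longrightarrow> (\<lambda>n::nat. act g (v n)) \<longlonglongrightarrow> act g x"
  by (rule continuous_on_tendsto_compose[OF continuous_act_right]) auto

lemma closed_act_le:
  assumes "x \<in> X"
  shows "closed {g. y \<le> act g x}" "closed {g. act g x \<le> y}"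
proof -
  have "closed ((\<lambda>g. act g x - y) -` {v. 0 \<le> v})" "closed ((\<lambda>g. y - act g x) -` {v. 0 \<le> v})"
    by (intro closed_vimage closed_cone continuous_intros continuous_act_left assms)+
  then show "closed {g. y \<le> act g x}" "closed {g. act g x \<le> y}"
    by (simp_all add: vimage_def)
qed

lemma omega_limitE:
  assumes "(y, w) \<in> omega_limit P (x, w0)"
  obtains t :: "nat \<Rightarrow> real" where "\<And>n. 0 \<le> t n" "filterlim t at_top sequentially"
    "(\<lambda>n. u (t n) x w0) \<longlonglongrightarrow> y" "(\<lambda>n. \<phi> w0 (t n)) \<longlonglongrightarrow> w"
proof -
  obtain t :: "nat \<Rightarrow> real" where t: "\<forall>n. 0 \<le> t n" "filterlim t at_top sequentially"
    "(\<lambda>n. P (t n) (x, w0)) \<longlonglongrightarrow> (y, w)"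
    using assms unfolding omega_limit_def by auto
  with tendsto_fst[OF t(3)] tendsto_snd[OF t(3)] show ?thesis
    by (intro that[of t]) (simp_all add: P_pair)
qed

lemma translate_K: "translate act g K = {(act g (ubar w), w) |w. True}"
  by (auto simp: translate_def K_eq)

section \<open>Comparable translates of \<open>K\<close> coincide\<close>

text \<open>The \<open>g\<close> that move \<open>K\<close> down form a closed subsemigroup
  containing the unit; compactness of \<open>G\<close> makes it closed under inverses.\<close>

lemma act_ubar_le_imp_eq:
  assumes "\<And>w. act h (ubar w) \<le> ubar w"
  shows "act h (ubar w) = ubar w"
proof -
  define S where "S = {g. \<forall>w. act g (ubar w) \<le> ubar w}"
  have "S = (\<Inter>w. {g. act g (ubar w) \<le> ubar w})"
    by (auto simp: S_def)
  then have "closed S"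
    by (auto intro!: closed_INT closed_act_le ubar_X)
  moreover have "0 \<in> S"
    by (simp add: S_def act_0 ubar_X)
  moreover have "a + b \<in> S" if "a \<in> S" "b \<in> S" for a b
  proof -
    have "act (a + b) (ubar w) \<le> ubar w" for w
    proof -
      have "act a (act b (ubar w)) \<le> act a (ubar w)"
        using that by (intro act_mono act_X ubar_X) (simp add: S_def)
      also have "\<dots> \<le> ubar w"
        using that by (simp add: S_def)
      finally show ?thesis
        by (simp add: act_add ubar_X)
    qed
    then show ?thesis
      by (simp add: S_def)
  qed
  ultimately have "- h \<in> S"
    using assms by (intro closed_semigroup_uminus[OF G_compact]) (auto simp: S_def)
  \<comment> \<open>Applying \<open>h\<close> to the inequality for \<open>- h\<close> gives the
    reverse inequality for \<open>h\<close>.\<close>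
  then have "act h (act (- h) (ubar w)) \<le> act h (ubar w)"
    by (intro act_mono) (auto simp: S_def ubar_X act_X)
  with assms show ?thesis
    by (simp add: act_minus ubar_X order_antisym)
qed

text \<open>The inverse \<open>- h\<close> moves \<open>K\<close> down, so the previous case applies
  to it.\<close>

lemma act_ubar_ge_imp_eq:
  assumes "\<And>w. ubar w \<le> act h (ubar w)"
  shows "act h (ubar w) = ubar w"
proof -
  have "act (- h) (ubar w) = ubar w" for w
    using act_mono[OF ubar_X act_X[OF ubar_X] assms, of "- h"]
    by (intro act_ubar_le_imp_eq) (simp add: act_minus ubar_X)
  from this[of w] show ?thesis
    by (metis act_minus(2) ubar_X)
qed

section \<open>Stability and omega-limit sets\<close>

lemma stable_nbhd:
  assumes "\<epsilon> > 0"
  obtains \<eta> where "\<eta> > 0"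
    "\<And>y w t. y \<in> X \<Longrightarrow> norm (y - ubar w) \<le> \<eta> \<Longrightarrow> 0 \<le> t \<Longrightarrow>
      norm (u t y w - ubar (\<phi> w t)) < \<epsilon>"
proof -
  obtain \<eta> where "\<eta> > 0" and \<eta>: "\<And>x y w t. (x, w) \<in> K \<Longrightarrow> y \<in> X \<Longrightarrow> norm (x - y) \<le> \<eta> \<Longrightarrow>
      0 \<le> t \<Longrightarrow> norm (u t x w - u t y w) < \<epsilon>"
    using K_stable assms unfolding uniformly_stable_def by metis
  show ?thesis
  proof (rule that[OF \<open>\<eta> > 0\<close>])
    fix y w t
    assume "y \<in> X" "norm (y - ubar w) \<le> \<eta>" "0 \<le> (t::real)"
    then show "norm (u t y w - ubar (\<phi> w t)) < \<epsilon>"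
      using \<eta>[of "ubar w" w y t] by (auto simp: K_eq norm_minus_commute ubar_orbit)
  qed
qed

lemma omega_limit_X:
  assumes "x \<in> X" "(y, w) \<in> omega_limit P (x, w0)"
  shows "y \<in> X"
  using assms(2)
proof (rule omega_limitE)
  fix t :: "nat \<Rightarrow> real"
  assume "\<And>n. 0 \<le> t n" "(\<lambda>n. u (t n) x w0) \<longlonglongrightarrow> y"
  then show ?thesis
    using closed_sequentially[OF X_closed, of "\<lambda>n. u (t n) x w0"] assms(1) u_X by blast
qed

lemma omega_limit_near:
  assumes near: "\<And>t. 0 \<le> t \<Longrightarrow> norm (u t x w0 - ubar (\<phi> w0 t)) < \<epsilon>"
    and "(y, w) \<in> omega_limit P (x, w0)"
  shows "norm (y - ubar w) \<le> \<epsilon>"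
  using assms(2)
proof (rule omega_limitE)
  fix t :: "nat \<Rightarrow> real"
  assume t: "\<And>n. 0 \<le> t n" "(\<lambda>n. u (t n) x w0) \<longlonglongrightarrow> y" "(\<lambda>n. \<phi> w0 (t n)) \<longlonglongrightarrow> w"
  have "(\<lambda>n. norm (u (t n) x w0 - ubar (\<phi> w0 (t n)))) \<longlonglongrightarrow> norm (y - ubar w)"
    by (intro tendsto_intros tendsto_ubar t)
  then show ?thesis
    by (rule LIMSEQ_le_const2) (use near t(1) in \<open>auto intro: less_imp_le\<close>)
qed

text \<open>Since the action commutes with the semiflow, \<open>act h (ubar w0)\<close> travels
  along \<open>hK\<close>. Monotonicity keeps the orbit of \<open>x\<close> below it, and the closed
  cone passes this to limits.\<close>

lemma omega_limit_le_act:
  assumes "x \<in> X" "x \<le> act h (ubar w0)" "(y, w) \<in> omega_limit P (x, w0)"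
  shows "y \<le> act h (ubar w)"
  using assms(3)
proof (rule omega_limitE)
  fix t :: "nat \<Rightarrow> real"
  assume t: "\<And>n. 0 \<le> t n" "(\<lambda>n. u (t n) x w0) \<longlonglongrightarrow> y" "(\<lambda>n. \<phi> w0 (t n)) \<longlonglongrightarrow> w"
  have "(\<lambda>n. act h (ubar (\<phi> w0 (t n)))) \<longlonglongrightarrow> act h (ubar w)"
    by (intro tendsto_act tendsto_ubar t ubar_X)
  then show ?thesis
  proof (rule closed_cone_limit_le[OF closed_cone t(2)])
    fix n
    show "u (t n) x w0 \<le> act h (ubar (\<phi> w0 (t n)))"
      using u_mono[OF t(1) assms(1) act_X[OF ubar_X] assms(2), of n w0]
      by (simp add: act_u[symmetric] ubar_X t(1) ubar_orbit)
  qed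
qed

text \<open>Recurrence gives times at which the base point tends to \<open>w\<close>; relative
  compactness of the orbit makes the other component converge along a subsequence.\<close>

lemma omega_limit_covers:
  assumes "(x, w0) \<in> tube X ubar \<delta>"
  obtains y where "(y, w) \<in> omega_limit P (x, w0)"
proof -
  obtain t :: "nat \<Rightarrow> real" where t: "\<And>n. 0 \<le> t n" "filterlim t at_top sequentially"
    "(\<lambda>n. \<phi> w0 (t n)) \<longlonglongrightarrow> w"
    using minimal_flow_recurrent[OF Omega_compact flow Omega_minimal] by metis
  have "P (t n) (x, w0) \<in> closure (forward_orbit P (x, w0))" for n
    using t(1) by (intro closure_subset[THEN subsetD]) (auto simp: forward_orbit_def)
  then obtain z r where z: "strict_mono r" "((\<lambda>n. P (t n) (x, w0)) \<circ> r) \<longlonglongrightarrow> z"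
    using relatively_compact[OF assms]
    unfolding compact_eq_seq_compact_metric seq_compact_def by meson
  have "(\<lambda>n. \<phi> w0 (t (r n))) \<longlonglongrightarrow> snd z"
    using tendsto_snd[OF z(2)] by (simp add: o_def P_pair)
  moreover have "(\<lambda>n. \<phi> w0 (t (r n))) \<longlonglongrightarrow> w"
    using LIMSEQ_subseq_LIMSEQ[OF t(3) z(1)] by (simp add: o_def)
  ultimately have "snd z = w"
    using LIMSEQ_unique by blast
  moreover have "z \<in> omega_limit P (x, w0)"
    unfolding omega_limit_def
    using z(2) t(1) filterlim_compose[OF t(2) filterlim_subseq[OF z(1)]]
    by (auto simp: o_def intro!: exI[of _ "\<lambda>n. t (r n)"])
  ultimately show ?thesis
    using that by (metis prod.collapse)
qed

lemma omega_limit_touching: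
  assumes x: "x \<in> X" and touch: "(act h (ubar w), w) \<in> omega_limit P (x, w0)"
    and y: "(y, w') \<in> omega_limit P (x, w0)"
  shows "y = act h (ubar w')"
proof -
  \<comment> \<open>Pulling the orbit back by \<open>- h\<close> makes it touch \<open>K\<close> itself, where stability applies.\<close>
  define \<xi> where "\<xi> = act (- h) x"
  have \<xi>: "\<xi> \<in> X"
    using x by (simp add: \<xi>_def act_X)
  have lim: "(\<lambda>n. u (t n) \<xi> w0 - ubar (\<phi> w0 (t n))) \<longlonglongrightarrow> act (- h) v - ubar w1"
    if "\<And>n. 0 \<le> t n" "(\<lambda>n. u (t n) x w0) \<longlonglongrightarrow> v" "(\<lambda>n. \<phi> w0 (t n)) \<longlonglongrightarrow> w1" "v \<in> X"
    for t :: "nat \<Rightarrow> real" and v w1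
  proof -
    have "(\<lambda>n. act (- h) (u (t n) x w0)) \<longlonglongrightarrow> act (- h) v"
      using that x by (intro tendsto_act u_X)
    then show ?thesis
      using that x by (intro tendsto_diff tendsto_ubar) (simp_all add: \<xi>_def act_u)
  qed
  obtain t :: "nat \<Rightarrow> real" where t: "\<And>n. 0 \<le> t n" "filterlim t at_top sequentially"
    "(\<lambda>n. u (t n) x w0) \<longlonglongrightarrow> act h (ubar w)" "(\<lambda>n. \<phi> w0 (t n)) \<longlonglongrightarrow> w"
    using omega_limitE[OF touch] by blast
  obtain s :: "nat \<Rightarrow> real" where s: "\<And>n. 0 \<le> s n" "filterlim s at_top sequentially"
    "(\<lambda>n. u (s n) x w0) \<longlonglongrightarrow> y" "(\<lambda>n. \<phi> w0 (s n)) \<longlonglongrightarrow> w'"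
    using omega_limitE[OF y] by blast
  have y_X: "y \<in> X"
    using omega_limit_X x y by blast
  have t0: "(\<lambda>n. u (t n) \<xi> w0 - ubar (\<phi> w0 (t n))) \<longlonglongrightarrow> 0"
    using lim[OF t(1,3,4)] by (simp add: act_X ubar_X act_minus)
  have "norm (act (- h) y - ubar w') \<le> \<epsilon>" if \<epsilon>: "\<epsilon> > 0" for \<epsilon>
  proof -
    obtain \<eta> where "\<eta> > 0" and \<eta>: "\<And>y w t. y \<in> X \<Longrightarrow> norm (y - ubar w) \<le> \<eta> \<Longrightarrow> 0 \<le> t \<Longrightarrow>
      norm (u t y w - ubar (\<phi> w t)) < \<epsilon>"
      using stable_nbhd[OF \<epsilon>] by blast
    obtain n where n: "norm (u (t n) \<xi> w0 - ubar (\<phi> w0 (t n))) < \<eta>"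
      using LIMSEQ_D[OF t0 \<open>\<eta> > 0\<close>] by auto
    \<comment> \<open>Stability is restarted at the time \<open>t n\<close>, when the orbit is close
      to \<open>K\<close>, and controls all later times.\<close>
    have late: "norm (u r \<xi> w0 - ubar (\<phi> w0 r)) < \<epsilon>" if "r \<ge> t n" for r
      using \<eta>[OF u_X[OF t(1) \<xi>], of n w0 "\<phi> w0 (t n)" "r - t n"] n that t(1)[of n]
        u_add[OF t(1) _ \<xi>, of "r - t n" n w0] flow_add[of w0 "t n" "r - t n"]
      by simp
    \<comment> \<open>The times \<open>s k\<close> eventually exceed \<open>t n\<close>, so the
      bound passes to the limit along \<open>s\<close>.\<close>
    have "eventually (\<lambda>k. s k \<ge> t n) sequentially"
      using s(2) by (simp add: filterlim_at_top)
    then have "eventually (\<lambda>k. norm (u (s k) \<xi> w0 - ubar (\<phi> w0 (s k))) \<le> \<epsilon>) sequentially"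
      by eventually_elim (simp add: late less_imp_le)
    then show ?thesis
      using tendsto_norm[OF lim[OF s(1,3,4) y_X]]
      by (intro tendsto_upperbound[of _ _ sequentially]) auto
  qed
  then have "norm (act (- h) y - ubar w') \<le> 0"
    by (rule dense_ge)
  then have "act (- h) y = ubar w'"
    by simp
  then show ?thesis
    by (metis act_minus(2) y_X)
qed

section \<open>The dichotomy for omega-limit sets of points below \<open>K\<close>\<close>

lemma omega_limit_dichotomy:
  assumes x: "x \<in> X" "x \<le> ubar w0" and tube: "(x, w0) \<in> tube X ubar \<delta>"
    and omega_tube: "omega_limit P (x, w0) \<subseteq> tube X ubar \<delta>"
    and not_K: "\<not> omega_limit P (x, w0) \<subseteq> K"
  shows "set_less (omega_limit P (x, w0)) (translate act h K)"
proof -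
  define A where "A = {g. \<forall>(y, w) \<in> omega_limit P (x, w0). y \<le> act g (ubar w)}"
  have "0 \<in> A"
    using omega_limit_le_act[OF x(1), of 0 w0] x(2) unfolding A_def
    by (auto simp: act_0 ubar_X)
  have less: "set_less (omega_limit P (x, w0)) (translate act g K)" if "g \<in> A" for g
  proof -
    have "y < act g (ubar w)" if y: "(y, w) \<in> omega_limit P (x, w0)" for y w
    proof (rule ccontr)
      assume "\<not> ?thesis"
      \<comment> \<open>Membership of \<open>g\<close> in \<open>A\<close> gives
        \<open>\<le>\<close>, so failure of strictness means equality.\<close>
      then have touch: "(act g (ubar w), w) \<in> omega_limit P (x, w0)"
        using y \<open>g \<in> A\<close> unfolding A_def by (auto simp: less_le)
      \<comment> \<open>After contact the omega-limit point over \<open>w'\<close> is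
        \<open>act g (ubar w')\<close>; it lies below \<open>ubar w'\<close> because the unit is in
        \<open>A\<close>.\<close>
      have "act g (ubar w') \<le> ubar w'" for w'
      proof -
        obtain y' where "(y', w') \<in> omega_limit P (x, w0)"
          using omega_limit_covers[OF tube] by blast
        then show ?thesis
          using omega_limit_touching[OF x(1) touch] \<open>0 \<in> A\<close>
          unfolding A_def by (fastforce simp: act_0 ubar_X)
      qed
      then have "omega_limit P (x, w0) \<subseteq> K"
        using omega_limit_touching[OF x(1) touch] act_ubar_le_imp_eq by (auto simp: K_eq)
      with not_K show False ..
    qed
    then show ?thesis
      using omega_limit_covers[OF tube] unfolding set_less_def translate_K by blast
  qed
  have "A = (\<Inter>(y, w) \<in> omega_limit P (x, w0). {g. y \<le> act g (ubar w)})"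
    by (auto simp: A_def)
  then have "closed A"
    by (auto intro!: closed_INT closed_act_le ubar_X)
  moreover have "open A"
  proof (rule Topological_Spaces.openI)
    fix h assume "h \<in> A"
    then obtain B where B: "open B" "0 \<in> B"
      "\<And>g. g \<in> B \<Longrightarrow> set_less (omega_limit P (x, w0)) (translate act (g + h) K)"
      using push_less[OF tube omega_tube less[OF \<open>h \<in> A\<close>]] by (auto intro: that)
    \<comment> \<open>Here \<open>k = (k - h) + h\<close>, and over each base point
      \<open>kK\<close> has the single point \<open>act k (ubar w)\<close>, so
      \<open>set_less\<close> yields the inequality required by \<open>A\<close>.\<close>
    have "k \<in> A" if "k - h \<in> B" for k
      using B(3)[OF that] unfolding A_def set_less_def translate_K
      by (fastforce intro: less_imp_le)
    then show "\<exists>T. open T \<and> h \<in> T \<and> T \<subseteq> A"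
      using open_right_translate[OF B(1), of h] B(2)
      by (intro exI[of _ "{k. k - h \<in> B}"]) auto
  qed
  ultimately have "A = UNIV"
    using connected_clopen_UNIV[OF G_connected] \<open>0 \<in> A\<close> by blast
  then show ?thesis
    using less by blast
qed

lemma tube_nbhd:
  assumes "\<epsilon> > 0"
  obtains \<eta> where "\<eta> > 0"
    "\<And>x w0. x \<in> X \<Longrightarrow> norm (x - ubar w0) < \<eta> \<Longrightarrow> (x, w0) \<in> tube X ubar \<delta> \<and>
       omega_limit P (x, w0) \<subseteq> tube X ubar \<delta> \<and>
       (\<forall>(y, w) \<in> omega_limit P (x, w0). norm (y - ubar w) \<le> \<epsilon>)"
proof -
  \<comment> \<open>Limits turn \<open><\<close> into \<open>\<le>\<close>, so the bound is taken
    strictly below \<open>\<delta>\<close> to keep the omega-limit set inside the tube.\<close>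
  define e where "e = min \<epsilon> (\<delta> / 2)"
  have e: "e > 0" "e \<le> \<epsilon>" "e < \<delta>"
    using assms delta_pos by (auto simp: e_def)
  obtain \<eta> where "\<eta> > 0" and \<eta>: "\<And>y w t. y \<in> X \<Longrightarrow> norm (y - ubar w) \<le> \<eta> \<Longrightarrow> 0 \<le> t \<Longrightarrow>
      norm (u t y w - ubar (\<phi> w t)) < e"
    using stable_nbhd[OF e(1)] by blast
  show ?thesis
  proof (rule that)
    show "min \<eta> \<delta> > 0"
      using \<open>\<eta> > 0\<close> delta_pos by simp
    fix x w0
    assume x: "x \<in> X" "norm (x - ubar w0) < min \<eta> \<delta>"
    have near: "norm (y - ubar w) \<le> e" if "(y, w) \<in> omega_limit P (x, w0)" for y w
      using omega_limit_near[OF \<eta> that] x by simp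
    with x e omega_limit_X[OF x(1)]
    show "(x, w0) \<in> tube X ubar \<delta> \<and> omega_limit P (x, w0) \<subseteq> tube X ubar \<delta> \<and>
       (\<forall>(y, w) \<in> omega_limit P (x, w0). norm (y - ubar w) \<le> \<epsilon>)"
      by (fastforce simp: tube_def)
  qed
qed

section \<open>The two cases and the conclusion\<close>

text \<open>By the dichotomy each such omega-limit set lies below \<open>gK\<close>, while stability
  puts it within any prescribed distance of \<open>K\<close>; the closed cone gives the inequality
  in the limit.\<close>

lemma all_act_ge_if_not_attracting:
  assumes "\<And>\<eta>. \<eta> > 0 \<Longrightarrow> \<exists>x\<in>X. x \<le> ubar w0 \<and> norm (x - ubar w0) < \<eta> \<and>
    \<not> omega_limit P (x, w0) \<subseteq> K"
  shows "ubar w \<le> act g (ubar w)"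
proof -
  have "\<exists>y. y \<le> act g (ubar w) \<and> norm (y - ubar w) \<le> inverse (real (Suc n))" for n
  proof -
    obtain \<eta> where "\<eta> > 0" and \<eta>: "\<And>x w0. x \<in> X \<Longrightarrow> norm (x - ubar w0) < \<eta> \<Longrightarrow>
       (x, w0) \<in> tube X ubar \<delta> \<and> omega_limit P (x, w0) \<subseteq> tube X ubar \<delta> \<and>
       (\<forall>(y, w) \<in> omega_limit P (x, w0). norm (y - ubar w) \<le> inverse (real (Suc n)))"
      using tube_nbhd[of "inverse (real (Suc n))"] by auto
    obtain x where x: "x \<in> X" "x \<le> ubar w0" "norm (x - ubar w0) < \<eta>"
      "\<not> omega_limit P (x, w0) \<subseteq> K"
      using assms[OF \<open>\<eta> > 0\<close>] by blast
    have "set_less (omega_limit P (x, w0)) (translate act g K)"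
      using omega_limit_dichotomy x \<eta>[OF x(1,3)] by blast
    then obtain y where "(y, w) \<in> omega_limit P (x, w0)" "y < act g (ubar w)"
      unfolding set_less_def translate_K by blast
    with \<eta>[OF x(1,3)] show ?thesis
      by (auto intro: less_imp_le)
  qed
  then obtain y where y: "\<And>n. y n \<le> act g (ubar w)"
    "\<And>n. norm (y n - ubar w) \<le> inverse (real (Suc n))"
    by metis
  have "y \<longlonglongrightarrow> ubar w"
    by (rule LIM_zero_cancel, rule Lim_null_comparison[OF _ LIMSEQ_inverse_real_of_nat])
      (use y(2) in \<open>auto intro!: always_eventually\<close>)
  then show ?thesis
    by (rule closed_cone_limit_le[OF closed_cone _ tendsto_const y(1)])
qed

lemma act_ubar_eq_if_attracting:
  assumes "\<eta> > 0" and attr: "\<And>x. x \<in> X \<Longrightarrow> x \<le> ubar w0 \<Longrightarrow> norm (x - ubar w0) < \<eta> \<Longrightarrow>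
    omega_limit P (x, w0) \<subseteq> K"
  shows "act g (ubar w) = ubar w"
proof -
  \<comment> \<open>Only membership in the tube is wanted, so that omega-limit sets meet every
    fiber; the bound \<open>1\<close> is arbitrary.\<close>
  obtain \<eta>' where "\<eta>' > 0" and \<eta>': "\<And>x w0. x \<in> X \<Longrightarrow> norm (x - ubar w0) < \<eta>' \<Longrightarrow>
      (x, w0) \<in> tube X ubar \<delta>"
    using tube_nbhd[OF zero_less_one] by metis
  obtain meet where meet: "\<And>a b. a \<in> X \<Longrightarrow> b \<in> X \<Longrightarrow> is_glb_in X a b (meet a b)"
    and cont: "continuous_on (X \<times> X) (\<lambda>(a, b). meet a b)"
    using X_meet unfolding has_continuous_meet_def by blast
  define m where "m g = meet (ubar w0) (act g (ubar w0))" for g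
  have m: "m g \<in> X" "m g \<le> ubar w0" "m g \<le> act g (ubar w0)" for g
    using meet[OF ubar_X act_X[OF ubar_X]] by (auto simp: m_def is_glb_in_def)
  have "ubar w0 \<le> m 0"
    using meet[OF ubar_X ubar_X] by (simp add: m_def is_glb_in_def act_0 ubar_X)
  then have m_0: "m 0 = ubar w0"
    using m(2) by (simp add: order_antisym)
  have "continuous_on UNIV m"
    using continuous_on_compose2[OF cont, of UNIV "\<lambda>g. (ubar w0, act g (ubar w0))"]
    by (simp add: m_def continuous_on_Pair continuous_act_left ubar_X act_X image_subset_iff)
  then have "open (m -` ball (ubar w0) (min \<eta> \<eta>'))"
    by (intro open_vimage) auto
  moreover define N where "N = m -` ball (ubar w0) (min \<eta> \<eta>')"
  ultimately have N: "open N" "0 \<in> N"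
    using \<open>\<eta> > 0\<close> \<open>\<eta>' > 0\<close> by (auto simp: m_0)
  \<comment> \<open>The meet \<open>m g\<close> is attracted to \<open>K\<close>, but it starts
    below \<open>act g (ubar w0)\<close>, so its limits on \<open>K\<close> stay below
    \<open>gK\<close>.\<close>
  have fix_N: "act g (ubar w) = ubar w" if "g \<in> N" for g w
  proof (rule act_ubar_ge_imp_eq)
    fix w
    have near: "norm (m g - ubar w0) < \<eta>" "norm (m g - ubar w0) < \<eta>'"
      using that by (auto simp: N_def dist_norm norm_minus_commute)
    obtain y where "(y, w) \<in> omega_limit P (m g, w0)"
      using omega_limit_covers[OF \<eta>'[OF m(1) near(2)]] .
    moreover from this have "y = ubar w"
      using attr[OF m(1,2) near(1)] by (auto simp: K_eq)
    ultimately show "ubar w \<le> act g (ubar w)"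
      using omega_limit_le_act[OF m(1,3)] by blast
  qed
  define H where "H = {g. \<forall>w. act g (ubar w) = ubar w}"
  \<comment> \<open>Antisymmetry of the order exhibits the stabilizer as an intersection of closed
    sets.\<close>
  have "H = (\<Inter>w. {g. act g (ubar w) \<le> ubar w} \<inter> {g. ubar w \<le> act g (ubar w)})"
    by (auto simp: H_def intro: order_antisym)
  then have "closed H"
    by (auto intro!: closed_INT closed_Int closed_act_le ubar_X)
  moreover have "open H"
  proof (rule Topological_Spaces.openI)
    fix h assume "h \<in> H"
    have "k \<in> H" if "k - h \<in> N" for k
      using fix_N[OF that] act_add[OF ubar_X, of "k - h" h] \<open>h \<in> H\<close> by (simp add: H_def)
    then show "\<exists>T. open T \<and> h \<in> T \<and> T \<subseteq> H"
      using open_right_translate[OF N(1), of h] N(2)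
      by (intro exI[of _ "{k. k - h \<in> N}"]) auto
  qed
  moreover have "0 \<in> H"
    by (simp add: H_def act_0 ubar_X)
  ultimately have "H = UNIV"
    using connected_clopen_UNIV[OF G_connected] by blast
  then show ?thesis
    by (auto simp: H_def)
qed

text \<open>The alternative is posed at one base point only, since either case yields its conclusion
  over every base point.\<close>

lemma act_ubar: "act g (ubar w) = ubar w"
proof (cases "\<exists>\<eta>>0. \<forall>x\<in>X. x \<le> ubar w \<longrightarrow> norm (x - ubar w) < \<eta> \<longrightarrow> omega_limit P (x, w) \<subseteq> K")
  case True
  then show ?thesis
    using act_ubar_eq_if_attracting by metis
next
  case False
  then show ?thesis
    by (intro act_ubar_ge_imp_eq all_act_ge_if_not_attracting[of w]) blast
qed

end

theorem theoremC:
  fixes X :: "'v::{banach, ordered_real_vector} set"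
    and \<phi> :: "'w::metric_space \<Rightarrow> real \<Rightarrow> 'w"
    and u :: "real \<Rightarrow> 'v \<Rightarrow> 'w \<Rightarrow> 'v"
    and P :: "real \<Rightarrow> 'v \<times> 'w \<Rightarrow> 'v \<times> 'w"
    and act :: "'g::topological_group_add \<Rightarrow> 'v \<Rightarrow> 'v"
    and ubar :: "'w \<Rightarrow> 'v"
    and K :: "('v \<times> 'w) set"
    and \<delta> :: real
  assumes closed_cone: "closed {v::'v. 0 \<le> v}"
    and X_closed: "closed X"
    and X_order_convex: "order_convex X"
    and X_meet: "has_continuous_meet X"
    and Omega_compact: "compact (UNIV :: 'w set)"
    and flow: "continuous_flow \<phi>"
    and Omega_minimal: "minimal_flow \<phi>"
    and semiflow: "skew_product_semiflow X \<phi> u"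
    and P_eq: "P = skew_product u \<phi>"
    and monotone: "monotone_semiflow X u"
    and G_metrizable: "metrizable_space (euclidean :: 'g topology)"
    and G_connected: "connected (UNIV :: 'g set)"
    and G_locally_compact: "locally_compact_space (euclidean :: 'g topology)"
    and action: "continuous_action X act"
    and action_order: "order_preserving_action X act"
    and action_commutes: "action_commutes X act u"
    and K_eq: "K = {(ubar w, w) |w. True}"
    and K_minimal: "minimal_set P K"
    and K_one_cover: "one_cover X P K"
    and K_stable: "uniformly_stable X u K"
    and delta_pos: "\<delta> > 0"
    and relatively_compact:
      "\<And>z. z \<in> tube X ubar \<delta> \<Longrightarrow> compact (closure (forward_orbit P z))"
    and push_less:
      "\<And>z h. z \<in> tube X ubar \<delta> \<Longrightarrow> omega_limit P z \<subseteq> tube X ubar \<delta> \<Longrightarrow>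
         set_less (omega_limit P z) (translate act h K) \<Longrightarrow>
         \<exists>B. open B \<and> 0 \<in> B \<and>
           (\<forall>g\<in>B. set_less (omega_limit P z) (translate act (g + h) K))"
    and push_greater:
      "\<And>z h. z \<in> tube X ubar \<delta> \<Longrightarrow> omega_limit P z \<subseteq> tube X ubar \<delta> \<Longrightarrow>
         set_greater (omega_limit P z) (translate act h K) \<Longrightarrow>
         \<exists>B. open B \<and> 0 \<in> B \<and>
           (\<forall>g\<in>B. set_greater (omega_limit P z) (translate act (g + h) K))"
    and G_compact: "compact (UNIV :: 'g set)"
  shows "group_orbit act K = K"
proof -
  interpret stable_cover X \<phi> u P act ubar K \<delta>
    by unfold_locales (fact assms)+
  have "group_orbit act K = {(act g (ubar w), w) |g w. True}"
    unfolding group_orbit_def K_eq by blast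
  then show ?thesis
    by (simp add: act_ubar K_eq)
qed

end
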